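(* Let $f\in\mathcal{S}$ be given by $f(z)=z+a_2z^2+a_3z^3+\cdots$ for $z\in\mathbb{D}$. Then $$|a_2a_3-a_4|\le 2.10064\ldots,$$ where $2.10064\ldots$ denotes the number $\max_{0\le x\le 1}\left(x+x^3+\frac{2}{\sqrt5}\sqrt{1-x^2}\right)$ (attained at $x=0.9740\ldots$).
   Context: $\mathbb{D}=\{z\in\mathbb{C}:|z|<1\}$ is the open unit disk. $\mathcal{A}$ is the class of functions $f$ analytic in $\mathbb{D}$ of the form $f(z)=z+a_2z^2+a_3z^3+\cdots$ (i.e. $f(0)=0$, $f'(0)=1$), with complex coefficients $a_n$. $\mathcal{S}$ is the subclass of $\mathcal{A}$ consisting of the functions that are univalent (injective) in $\mathbb{D}$. *)

theory Defs
  imports "HOL-Complex_Analysis.Complex_Analysis"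
begin

(* Functions on the open unit disk are total functions on the complex numbers
   of which only the values on the disk matter. *)

abbreviation unit_disk :: "complex set" where
  "unit_disk \<equiv> ball 0 1"

definition class_A :: "(complex \<Rightarrow> complex) set" where
  "class_A = {f. f analytic_on unit_disk \<and> f 0 = 0 \<and> deriv f 0 = 1}"

definition class_S :: "(complex \<Rightarrow> complex) set" where
  "class_S = {f \<in> class_A. inj_on f unit_disk}"

definition bound_fun :: "real \<Rightarrow> real" where
  "bound_fun x = x + x ^ 3 + 2 / sqrt 5 * sqrt (1 - x\<^sup>2)"

end

theory Submission
  imports Defs
begin

text \<open>
  Write \<open>f z = z \<phi>(z)\<close>, let \<open>\<psi>\<close> be the holomorphic square root of \<open>1/\<phi>\<close> with \<open>\<psi>(0) = 1\<close>, and let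
  \<open>\<psi>(z) = 1 + c\<^sub>1 z + c\<^sub>2 z^2 + c\<^sub>3 z^3 + \<dots>\<close> and \<open>\<psi>(z)^2 = 1 + d\<^sub>1 z + d\<^sub>2 z^2 + \<dots>\<close>. Comparing coefficients gives
  \<open>a\<^sub>2 a\<^sub>3 - a\<^sub>4 = 2 c\<^sub>3 - c\<^sub>1 d\<^sub>2 - c\<^sub>1^3\<close>. The area theorem for the univalent function
  \<open>1/f(z) = \<psi>(z)^2/z\<close> yields \<open>|d\<^sub>2| \<le> 1\<close>, and for its square root transform \<open>\<psi>(z^2)/z\<close> it yields
  \<open>|c\<^sub>1|^2 + 5 |c\<^sub>3|^2 \<le> 1\<close>; hence the bound with \<open>x = |c\<^sub>1|\<close>.

  For the area theorem let \<open>F(z) = 1/z + p(z)\<close> be univalent. The image of the circle \<open>|z| = e\<close> is close to an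
  ellipse, which the real linear map \<open>v \<mapsto> v - \<beta> e^2 cnj v\<close> with \<open>\<beta> = p'(0)\<close> straightens to the circle of
  radius \<open>1/e\<close> up to an error \<open>O(e^2)\<close>. The image of the annulus \<open>e < |z| < \<rho>\<close> lies inside this curve,
  so its area, computed by the change of variables formula and Fourier series, is at most
  \<open>\<pi>/e^2 + O(e)\<close>; then \<open>e \<rightarrow> 0\<close> and \<open>\<rho> \<rightarrow> 1\<close>.
\<close>

section \<open>Fourier coefficients on circles\<close>

text \<open>On \<open>|w| = r\<close> one has \<open>cnj w = r^2 / w\<close>, so this is Cauchy's
  coefficient formula scaled by \<open>r^(2k)\<close>. In the conjugate form, sums over
  \<open>k\<close> collapse to a single factor \<open>cnj (P w)\<close>.\<close>

lemma circle_coeff_integral: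
  fixes g :: "complex \<Rightarrow> complex"
  assumes hol: "g holomorphic_on ball 0 1" and G: "g has_fps_expansion G" and r: "0 < r" "r < 1"
  shows "((\<lambda>t. cnj (of_real r * cis t) ^ k * g (of_real r * cis t)) has_integral
           (2 * pi * of_real (r ^ (2 * k)) * fps_nth G k)) {0..2*pi}"
proof -
  have "continuous_on (cball 0 r) g" "g holomorphic_on ball 0 r"
    using holomorphic_on_subset[OF hol] r
    by (auto intro!: holomorphic_on_imp_continuous_on simp: subset_iff)
  from Cauchy_has_contour_integral_higher_derivative_circlepath[OF this, of 0 k] r
  have "((\<lambda>u. g u / u ^ Suc k) has_contour_integral (2 * pi * \<i> * fps_nth G k)) (part_circlepath 0 r 0 (2*pi))"
    by (simp add: fps_nth_fps_expansion[OF G] circlepath_def)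
  hence "((\<lambda>t. g (of_real r * cis t) / (of_real r * cis t) ^ Suc k * of_real r * \<i> * cis t) has_integral
           (2 * pi * \<i> * fps_nth G k)) {0..2*pi}"
    by (subst (asm) has_contour_integral_part_circlepath_iff) auto
  from has_integral_mult_right[OF this, of "of_real (r ^ (2 * k)) / \<i>"]
  have "((\<lambda>t. of_real (r ^ (2 * k)) / \<i> * (g (of_real r * cis t) / (of_real r * cis t) ^ Suc k * of_real r * \<i> * cis t)) has_integral
           (2 * pi * of_real (r ^ (2 * k)) * fps_nth G k)) {0..2*pi}"
    by (simp add: mult_ac)
  moreover have "of_real (r ^ (2 * k)) / \<i> * (g (of_real r * cis t) / (of_real r * cis t) ^ Suc k * of_real r * \<i> * cis t)
     = cnj (of_real r * cis t) ^ k * g (of_real r * cis t)" for t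
  proof -
    define w where "w = of_real r * cis t"
    have w: "w \<noteq> 0" "norm w = r" using r by (auto simp: w_def norm_mult)
    have "of_real (r ^ (2 * k)) = (w * cnj w) ^ k"
      unfolding complex_norm_square[symmetric] w(2) by (simp add: power_mult)
    hence "of_real (r ^ (2 * k)) / \<i> * (g w / w ^ Suc k * \<i> * w) = cnj w ^ k * g w"
      using w(1) by (simp add: power_mult_distrib mult_ac)
    thus ?thesis by (simp only: w_def mult_ac)
  qed
  ultimately show ?thesis by (simp only:)
qed

text \<open>With \<open>P\<close> the Taylor polynomial of degree below \<open>N\<close>,
  \<open>|g|^2 - |g - P|^2 = Re (cnj P * (2 * g - P))\<close>, and the right-hand side can be
  integrated exactly.\<close>

lemma Bessel_circle:
  fixes g :: "complex \<Rightarrow> complex"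
  assumes hol: "g holomorphic_on ball 0 1" and G: "g has_fps_expansion G" and r: "0 < r" "r < 1"
  shows "2 * pi * (\<Sum>k<N. (norm (fps_nth G k))\<^sup>2 * r ^ (2 * k)) \<le>
           integral {0..2*pi} (\<lambda>t. (norm (g (of_real r * cis t)))\<^sup>2)"
proof -
  define P where "P = (\<lambda>w. \<Sum>k<N. fps_nth G k * w ^ k)"
  \<comment> \<open>\<open>Q\<close> has the same coefficients as \<open>g\<close> below
    \<open>N\<close>, so pairing it with \<open>P\<close> produces the sum of squares
    directly.\<close>
  define Q where "Q = (\<lambda>w. 2 * g w - P w)"
  define w where "w = (\<lambda>t. of_real r * cis t)"
  define FP where "FP = (\<Sum>k<N. fps_const (fps_nth G k) * fps_X ^ k)"
  have "P has_fps_expansion FP"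
    unfolding P_def FP_def by (intro fps_expansion_intros)
  hence FQ: "Q has_fps_expansion (fps_const 2 * G - FP)"
    unfolding Q_def using G by (intro fps_expansion_intros)
  have nthQ: "fps_nth (fps_const 2 * G - FP) k = fps_nth G k" if "k < N" for k
    using that by (simp add: FP_def fps_sum_nth if_distrib cong: if_cong)
  have holQ: "Q holomorphic_on ball 0 1"
    unfolding Q_def P_def by (intro holomorphic_intros hol)
  have "((\<lambda>t. cnj (fps_nth G k) * (cnj (w t) ^ k * Q (w t))) has_integral
          cnj (fps_nth G k) * (2 * pi * of_real (r ^ (2 * k)) * fps_nth G k)) {0..2*pi}" if "k < N" for k
    using has_integral_mult_right[OF circle_coeff_integral[OF holQ FQ r]]
    unfolding w_def nthQ[OF that, symmetric] .
  hence "((\<lambda>t. \<Sum>k<N. cnj (fps_nth G k) * (cnj (w t) ^ k * Q (w t))) has_integral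
          (\<Sum>k<N. cnj (fps_nth G k) * (2 * pi * of_real (r ^ (2 * k)) * fps_nth G k))) {0..2*pi}"
    by (intro has_integral_sum) auto
  also have "(\<Sum>k<N. cnj (fps_nth G k) * (2 * pi * of_real (r ^ (2 * k)) * fps_nth G k)) =
     of_real (2 * pi * (\<Sum>k<N. (norm (fps_nth G k))\<^sup>2 * r ^ (2 * k)))"
    unfolding of_real_mult of_real_sum sum_distrib_left
    by (intro sum.cong refl) (simp add: complex_norm_square mult_ac del: of_real_power)
  also have "(\<lambda>t. \<Sum>k<N. cnj (fps_nth G k) * (cnj (w t) ^ k * Q (w t))) = (\<lambda>t. cnj (P (w t)) * Q (w t))"
    by (simp add: P_def sum_distrib_right mult.assoc)
  finally have "((\<lambda>t. cnj (P (w t)) * Q (w t)) has_integral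
      of_real (2 * pi * (\<Sum>k<N. (norm (fps_nth G k))\<^sup>2 * r ^ (2 * k)))) {0..2*pi}" .
  from has_integral_Re[OF this]
  have 1: "((\<lambda>t. Re (cnj (P (w t)) * Q (w t))) has_integral
      (2 * pi * (\<Sum>k<N. (norm (fps_nth G k))\<^sup>2 * r ^ (2 * k)))) {0..2*pi}"
    unfolding Re_complex_of_real .
  have "continuous_on {0..2*pi} (\<lambda>t. (norm (g (w t)))\<^sup>2)"
    unfolding w_def using r
    by (intro continuous_intros continuous_on_compose2[OF holomorphic_on_imp_continuous_on[OF hol]])
       (auto simp: norm_mult)
  hence 2: "((\<lambda>t. (norm (g (w t)))\<^sup>2) has_integral integral {0..2*pi} (\<lambda>t. (norm (g (w t)))\<^sup>2)) {0..2*pi}"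
    using integrable_continuous_real integrable_integral by blast
  \<comment> \<open>this is \<open>0 \<le> |u - p|^2\<close>\<close>
  have "Re (cnj p * (2 * u - p)) \<le> (norm u)\<^sup>2" for p u :: complex
    using zero_le_power2[of "norm (u - p)"]
    unfolding cmod_power2 by (simp add: algebra_simps power2_eq_square)
  thus ?thesis
    using has_integral_le[OF 1 2] by (auto simp: Q_def w_def)
qed

section \<open>The area theorem\<close>

text \<open>
  If \<open>F(\<zeta>)\<close> were outside, a half-plane would separate it from the image of the circle, so that the real
  part of a multiple of \<open>1/(F - F(\<zeta>))\<close> is negative on \<open>|z| = e\<close>; but this function is holomorphic
  inside the circle and vanishes at \<open>0\<close>, contradicting the maximum principle.
\<close>
lemma image_outside_circle_bound:
  fixes p :: "complex \<Rightarrow> complex"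
  assumes hol: "p holomorphic_on ball 0 1"
    and inj: "inj_on (\<lambda>z. 1 / z + p z) (ball 0 1 - {0})"
    and e: "0 < e" "e < norm \<zeta>" "norm \<zeta> < 1"
    and M: "\<And>z. norm z = e \<Longrightarrow> norm (1 / z + p z - b - c * cnj (1 / z + p z - b)) \<le> M"
  shows "norm (1 / \<zeta> + p \<zeta> - b - c * cnj (1 / \<zeta> + p \<zeta> - b)) \<le> M"
proof (rule ccontr)
  define T where "T = (\<lambda>v. v - c * cnj v)"
  define F where "F = (\<lambda>z. 1 / z + p z)"
  define u where "u = T (F \<zeta> - b)"
  \<comment> \<open>Up to conjugation, the adjoint of \<open>T\<close> applied to \<open>u\<close>:
    the real linear functional \<open>Re (cnj u * T v)\<close> of \<open>v\<close> becomes
    \<open>Re (\<alpha> * v)\<close>.\<close>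
  define \<alpha> where "\<alpha> = cnj u - u * cnj c"
  assume "\<not> ?thesis"
  hence Mu: "M < norm u" by (simp add: u_def T_def F_def)
  have Re\<alpha>: "Re (\<alpha> * v) = Re (cnj u * T v)" for v
    by (simp add: \<alpha>_def T_def algebra_simps)
  have neg: "Re (\<alpha> * (F z - F \<zeta>)) < 0" if "norm z = e" for z
  proof -
    have eq: "T (F z - F \<zeta>) = T (F z - b) - u" by (simp add: T_def u_def algebra_simps)
    have "Re (\<alpha> * (F z - F \<zeta>)) = Re (cnj u * T (F z - b)) - (norm u)\<^sup>2"
      unfolding Re\<alpha> eq cmod_power2 by (simp add: algebra_simps power2_eq_square)
    also have "Re (cnj u * T (F z - b)) \<le> norm u * norm (T (F z - b))"
      by (metis complex_Re_le_cmod norm_mult complex_mod_cnj)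
    also have "\<dots> \<le> norm u * M"
      using M[OF that] by (intro mult_left_mono) (auto simp: T_def F_def)
    also have "norm u * M < norm u * norm u"
      using Mu order_trans[OF norm_ge_zero M[of "of_real e"]] e
      by (intro mult_strict_left_mono) auto
    finally show ?thesis by (simp add: power2_eq_square)
  qed
  \<comment> \<open>This is \<open>1 / (F z - F \<zeta>)\<close> with numerator and denominator
    multiplied by \<open>z\<close>, which fills in the value 0 at the pole of
    \<open>F\<close>.\<close>
  define L where "L = (\<lambda>z. z / (1 + z * (p z - F \<zeta>)))"
  have nz: "1 + z * (p z - F \<zeta>) \<noteq> 0" if "norm z \<le> e" for z
  proof (cases "z = 0")
    case False
    hence eq: "1 + z * (p z - F \<zeta>) = z * (F z - F \<zeta>)" by (simp add: F_def field_simps)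
    have "z \<noteq> \<zeta>" "\<zeta> \<noteq> 0" using that e by auto
    hence "F z \<noteq> F \<zeta>"
      using inj_onD[OF inj, of z \<zeta>] that e False by (auto simp: F_def)
    with False show ?thesis unfolding eq by simp
  qed auto
  have holL: "L holomorphic_on cball 0 e"
    unfolding L_def using nz e
    by (intro holomorphic_intros holomorphic_on_subset[OF hol]) (auto simp: subset_iff)
  \<comment> \<open>The exponential turns the sign of the real part into a modulus:
    \<open>norm (E z) < 1\<close> on the circle, but \<open>E 0 = 1\<close>.\<close>
  define E where "E = (\<lambda>z. exp (cnj \<alpha> * L z))"
  have holE: "E holomorphic_on cball 0 e"
    unfolding E_def by (intro holomorphic_intros holL)
  have contE: "continuous_on (cball 0 e) E"
    by (rule holomorphic_on_imp_continuous_on[OF holE])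
  have less: "norm (E z) < 1" if z: "norm z = e" for z
  proof -
    have z0: "z \<noteq> 0" using z e by auto
    have Lz: "L z = 1 / (F z - F \<zeta>)"
      using z0 nz[of z] z by (simp add: L_def F_def field_simps)
    have "Re (cnj \<alpha> * L z) < 0"
    proof -
      have v0: "F z - F \<zeta> \<noteq> 0" using neg[OF z] by auto
      have "cnj \<alpha> * L z = cnj \<alpha> / (F z - F \<zeta>)"
        by (simp add: Lz)
      also have "\<dots> = cnj (\<alpha> * (F z - F \<zeta>)) / of_real ((norm (F z - F \<zeta>))\<^sup>2)"
        by (subst complex_div_cnj) simp
      finally have "Re (cnj \<alpha> * L z) = Re (\<alpha> * (F z - F \<zeta>)) / (norm (F z - F \<zeta>))\<^sup>2"
        by (simp only: Re_divide_of_real cnj.simps)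
      thus ?thesis using neg[OF z] v0 by (simp add: divide_less_0_iff)
    qed
    thus ?thesis by (simp add: E_def)
  qed
  have "compact (sphere (0::complex) e)" "sphere (0::complex) e \<noteq> {}" using e by auto
  then obtain z1 where z1: "norm z1 = e" "\<And>z. norm z = e \<Longrightarrow> norm (E z) \<le> norm (E z1)"
    using continuous_attains_sup[of "sphere 0 e" "\<lambda>z. norm (E z)"] contE
    by (force intro!: continuous_intros elim: continuous_on_subset)
  have "norm (E 0) \<le> norm (E z1)"
  proof (rule maximum_modulus_frontier[of E "cball 0 e"])
    show "E holomorphic_on interior (cball 0 e)"
      by (rule holomorphic_on_subset[OF holE]) auto
    show "continuous_on (closure (cball 0 e)) E" using contE by simp
    show "norm (E z) \<le> norm (E z1)" if "z \<in> frontier (cball 0 e)" for z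
      using that z1 e by simp
  qed (use e in auto)
  with less[OF z1(1)] show False by (simp add: E_def L_def)
qed

section \<open>Areas of images of rectangles\<close>

text \<open>Change of variables with determinants is applied on \<open>real^2\<close>, iterated
  integration on pairs of reals. The coordinate bijection maps boxes to boxes and preserves their
  content, so integrals carry over with scaling factor 1.\<close>

lemma has_integral_real2_iterated:
  fixes \<phi> :: "real \<Rightarrow> real \<Rightarrow> real"
  assumes cont: "continuous_on (cbox (a1, a2) (b1, b2)) (\<lambda>(s, t). \<phi> s t)"
    and ab: "a1 \<le> b1" "a2 \<le> b2"
  shows "((\<lambda>x::real^2. \<phi> (x $ 1) (x $ 2)) has_integral
           integral {a1..b1} (\<lambda>s. integral {a2..b2} (\<phi> s)))
         (cbox (vector [a1, a2]) (vector [b1, b2]))"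
proof -
  define g where "g = (\<lambda>x::real^2. (x $ 1, x $ 2))"
  define h where "h = (\<lambda>(s::real, t::real). vector [s, t] :: real^2)"
  have hg: "h (g x) = x" for x
    by (simp add: h_def g_def vec_eq_iff forall_2)
  have gh: "g (h x) = x" for x
    by (simp add: h_def g_def split_beta)
  have ex2: "(\<exists>i::2. Q i) \<longleftrightarrow> Q 1 \<or> Q 2" for Q
    using forall_2[of "\<lambda>i. \<not> Q i"] by blast
  have g_cbox: "g ` cbox u v = cbox (g u) (g v)" for u v
  proof -
    have iff: "x \<in> cbox u v \<longleftrightarrow> g x \<in> cbox (g u) (g v)" for x
      by (auto simp: g_def mem_box_cart forall_2)
    show ?thesis
    proof (intro equalityI subsetI)
      fix y assume "y \<in> cbox (g u) (g v)"
      hence "h y \<in> cbox u v" by (simp add: iff gh)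
      from imageI[OF this, of g] show "y \<in> g ` cbox u v" by (simp add: gh)
    qed (use iff in blast)
  qed
  have h_cbox: "h ` cbox u v = cbox (h u) (h v)" for u v
  proof -
    have "h ` cbox u v = h ` g ` cbox (h u) (h v)" by (simp add: g_cbox gh)
    thus ?thesis by (simp add: image_image hg)
  qed
  have "((\<lambda>x. (\<lambda>(s, t). \<phi> s t) (g x)) has_integral (1 / 1) *\<^sub>R
          integral (cbox (a1, a2) (b1, b2)) (\<lambda>(s, t). \<phi> s t)) (h ` cbox (a1, a2) (b1, b2))"
  proof (rule has_integral_twiddle)
    show "measure lborel (g ` cbox u v) = 1 * measure lborel (cbox u v)" for u v
      unfolding g_cbox using ex2
      by (simp add: g_def content_Pair content_cbox_if_cart forall_2 UNIV_2 interval_eq_empty_cart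
           cbox_interval[where 'a = real] content_real_if)
    show "\<exists>w z. g ` cbox u v = cbox w z" for u v using g_cbox by blast
    show "\<exists>w z. h ` cbox u v = cbox w z" for u v using h_cbox by blast
    show "continuous (at x) g" for x
      unfolding g_def by (intro continuous_intros)
    show "((\<lambda>(s, t). \<phi> s t) has_integral integral (cbox (a1, a2) (b1, b2)) (\<lambda>(s, t). \<phi> s t))
            (cbox (a1, a2) (b1, b2))"
      by (rule integrable_integral[OF integrable_continuous[OF cont]])
  qed (use hg gh in auto)
  thus ?thesis
    unfolding h_cbox integral_prod_continuous[OF cont]
    by (simp add: g_def h_def cbox_interval)
qed

text \<open>Multiplication by \<open>w\<close> has determinant \<open>|w|^2\<close> and subtracting
  \<open>c * cnj v\<close> contributes \<open>1 - |c|^2\<close>. The coordinate form matches the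
  derivative \<open>f'\<close> of the area computation below.\<close>

lemma det_linear_conj:
  fixes w c :: complex
  shows "det (matrix (\<lambda>h::real^2. let v = w * Complex (h $ 1) (h $ 2)
           in vector [Re (v - c * cnj v), Im (v - c * cnj v)] :: real^2))
         = (1 - (norm c)\<^sup>2) * (norm w)\<^sup>2"
  unfolding cmod_power2
  by (simp add: det_2 matrix_def axis_def Let_def algebra_simps power2_eq_square)

lemma continuous_on_Complex_cbox:
  assumes "continuous_on (cbox (Complex a1 a2) (Complex b1 b2)) f"
  shows "continuous_on (cbox (a1, a2) (b1, b2)) (\<lambda>x. f (Complex (fst x) (snd x)))"
proof (rule continuous_on_compose2[OF assms])
  show "continuous_on (cbox (a1, a2) (b1, b2)) (\<lambda>x. Complex (fst x) (snd x))"
    unfolding Complex_eq by (intro continuous_intros)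
  show "(\<lambda>x. Complex (fst x) (snd x)) ` cbox (a1, a2) (b1, b2) \<subseteq> cbox (Complex a1 a2) (Complex b1 b2)"
    by (auto simp: in_cbox_complex_iff cbox_Pair_eq)
qed

text \<open>Following \<open>H\<close> by the injective real linear map \<open>T\<close> gives an
  injective map with Jacobian \<open>(1 - |c|^2) |H'|^2\<close>. Its image lies in a disk of radius
  \<open>M\<close>, whose area is the right-hand side.\<close>

lemma linear_conj_image_area:
  fixes H :: "complex \<Rightarrow> complex"
  assumes hol: "H holomorphic_on U" and U: "open U" "cbox (Complex a1 a2) (Complex b1 b2) \<subseteq> U"
    and ab: "a1 \<le> b1" "a2 \<le> b2"
    and inj: "inj_on H (box (Complex a1 a2) (Complex b1 b2))"
    and c: "norm c < 1"
    and M: "0 \<le> M" "\<And>z. z \<in> box (Complex a1 a2) (Complex b1 b2) \<Longrightarrow> norm (H z - c * cnj (H z)) \<le> M"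
  shows "(1 - (norm c)\<^sup>2) * integral {a1..b1} (\<lambda>s. integral {a2..b2} (\<lambda>t. (norm (deriv H (Complex s t)))\<^sup>2))
           \<le> pi * M\<^sup>2"
proof -
  define T where "T = (\<lambda>v. v - c * cnj v)"
  define V where "V = (\<lambda>z. vector [Re z, Im z] :: real^2)"
  define P where "P = (\<lambda>x::real^2. Complex (x $ 1) (x $ 2))"
  define B where "B = (box (vector [a1, a2]) (vector [b1, b2]) :: (real^2) set)"
  define \<phi> where "\<phi> = (\<lambda>s t. (1 - (norm c)\<^sup>2) * (norm (deriv H (Complex s t)))\<^sup>2)"
  define I where "I = integral {a1..b1} (\<lambda>s. integral {a2..b2} (\<phi> s))"
  have c2: "0 < 1 - (norm c)\<^sup>2" using c by (simp add: abs_square_less_1)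
  have P_box: "P x \<in> box (Complex a1 a2) (Complex b1 b2)" if "x \<in> B" for x
    using that by (simp add: P_def B_def mem_box_cart forall_2 in_box_complex_iff)
  have box_U: "box (Complex a1 a2) (Complex b1 b2) \<subseteq> U"
    using U(2) box_subset_cbox by blast
  have "continuous_on (cbox (Complex a1 a2) (Complex b1 b2)) (deriv H)"
    using holomorphic_deriv[OF hol U(1)] U(2)
    by (meson holomorphic_on_imp_continuous_on continuous_on_subset)
  note continuous_on_Complex_cbox[OF this]
  hence cont: "continuous_on (cbox (a1, a2) (b1, b2)) (\<lambda>(s, t). \<phi> s t)"
    unfolding \<phi>_def split_beta by (intro continuous_intros)
  have int: "((\<lambda>x. \<phi> (x $ 1) (x $ 2)) has_integral I) B"
    unfolding B_def I_def has_integral_open_interval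
    by (rule has_integral_real2_iterated[OF cont ab])
  define f where "f = (\<lambda>x. V (T (H (P x))))"
  define f' where "f' = (\<lambda>x h. V (T (deriv H (P x) * P h)))"
  have lin: "bounded_linear P" "bounded_linear V" "bounded_linear T"
  proof -
    have "linear P" unfolding P_def by (auto intro!: linearI simp: complex_eq_iff)
    thus "bounded_linear P" by (rule linear_conv_bounded_linear[THEN iffD1])
    have "linear V" unfolding V_def by (auto intro!: linearI simp: vec_eq_iff forall_2)
    thus "bounded_linear V" by (rule linear_conv_bounded_linear[THEN iffD1])
    have "linear T" unfolding T_def by (auto intro!: linearI simp: algebra_simps)
    thus "bounded_linear T" by (rule linear_conv_bounded_linear[THEN iffD1])
  qed
  have deriv: "(f has_derivative f' x) (at x within B)" if "x \<in> B" for x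
  proof -
    have "(H has_field_derivative deriv H (P x)) (at (P x))"
      using P_box[OF that] box_U U(1) hol by (intro holomorphic_derivI[of H U]) auto
    hence "(H has_derivative (\<lambda>h. deriv H (P x) * h)) (at (P x))"
      by (simp add: has_field_derivative_def)
    from has_derivative_compose[OF bounded_linear_imp_has_derivative[OF lin(1)] this]
    have "((\<lambda>x. H (P x)) has_derivative (\<lambda>h. deriv H (P x) * P h)) (at x within B)" .
    from bounded_linear.has_derivative[OF lin(2) bounded_linear.has_derivative[OF lin(3) this]]
    show ?thesis unfolding f_def f'_def .
  qed
  have inj_T: "v = w" if "T v = T w" for v w
  proof -
    have "v - w = c * cnj (v - w)" using that by (simp add: T_def algebra_simps)
    hence "norm (v - w) = norm c * norm (v - w)" by (metis complex_mod_cnj norm_mult)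
    with c show ?thesis by auto
  qed
  have inj_f: "inj_on f B"
  proof (rule inj_onI)
    fix x y assume xy: "x \<in> B" "y \<in> B" "f x = f y"
    hence "T (H (P x)) = T (H (P y))"
      by (simp add: f_def V_def vec_eq_iff forall_2 complex_eq_iff)
    hence "P x = P y" using inj_onD[OF inj inj_T] P_box xy by blast
    thus "x = y" by (simp add: P_def vec_eq_iff forall_2)
  qed
  have "\<bar>det (matrix (f' x))\<bar> = \<phi> (x $ 1) (x $ 2)" for x
  proof -
    have "f' x = (\<lambda>h. let v = deriv H (P x) * Complex (h $ 1) (h $ 2)
            in vector [Re (v - c * cnj v), Im (v - c * cnj v)])"
      by (simp only: f'_def V_def T_def P_def Let_def)
    thus ?thesis
      using c2 by (simp only: det_linear_conj) (simp add: \<phi>_def P_def abs_mult)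
  qed
  with int have "((\<lambda>x. \<bar>det (matrix (f' x))\<bar>) has_integral I) B" by simp
  hence meas: "f ` B \<in> lmeasurable" "measure lebesgue (f ` B) = I"
    using has_measure_differentiable_image[OF _ deriv inj_f, of I] by (auto simp: B_def)
  have "f ` B \<subseteq> cball 0 M"
  proof safe
    fix x assume "x \<in> B"
    hence "norm (T (H (P x))) \<le> M" using M(2)[OF P_box] by (simp add: T_def)
    thus "f x \<in> cball 0 M"
      by (simp add: f_def V_def norm_vec_def L2_set_def UNIV_2 cmod_def)
  qed
  hence "I \<le> measure lebesgue (cball (0::real^2) M)"
    unfolding meas(2)[symmetric] by (intro measure_mono_fmeasurable) (use meas in auto)
  also have "\<dots> = pi * M\<^sup>2"
    using M(1) by (simp add: content_cball unit_ball_vol_2)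
  also have "I = (1 - (norm c)\<^sup>2) * integral {a1..b1} (\<lambda>s. integral {a2..b2} (\<lambda>t. (norm (deriv H (Complex s t)))\<^sup>2))"
    by (simp add: I_def \<phi>_def)
  finally show ?thesis .
qed

text \<open>In the coordinate \<open>\<zeta>\<close> with \<open>z = exp \<zeta>\<close> the slit
  annulus is a rectangle, so the area is an iterated integral over circles, each bounded below by
  Bessel's inequality.\<close>

lemma annulus_area_inequality:
  fixes p :: "complex \<Rightarrow> complex" and B :: "complex fps"
  assumes hol: "p holomorphic_on ball 0 1" and B: "p has_fps_expansion B"
    and inj: "inj_on (\<lambda>z. 1 / z + p z) (ball 0 1 - {0})"
    and e: "0 < e" "e < \<rho>" "\<rho> < 1" and c: "norm c < 1"
    and M: "\<And>z. norm z = e \<Longrightarrow> norm (1 / z + p z - b - c * cnj (1 / z + p z - b)) \<le> M"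
  shows "(1 - (norm c)\<^sup>2) * (1 / e\<^sup>2 - 1 / \<rho>\<^sup>2 +
           (\<Sum>n<N. n * (norm (fps_nth B n))\<^sup>2 * (\<rho> ^ (2 * n) - e ^ (2 * n)))) \<le> M\<^sup>2"
proof -
  define F where "F = (\<lambda>z. 1 / z + p z)"
  define H where "H = (\<lambda>\<zeta>. F (exp \<zeta>) - b)"
  define U where "U = {\<zeta>. Re \<zeta> < 0}"
  define a where "a n = real n * (norm (fps_nth B n))\<^sup>2" for n
  \<comment> \<open>This is \<open>z^2 * F'(z)\<close>: the pole is cleared, so the Bessel bound for
    functions holomorphic in the disk applies.\<close>
  define G where "G = (\<lambda>z. z ^ 2 * deriv p z - 1)"
  have norm_exp: "norm (exp \<zeta>) < 1" if "\<zeta> \<in> U" for \<zeta>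
    using that by (simp add: U_def)
  have U: "open U" "cbox (Complex (ln e) 0) (Complex (ln \<rho>) (2 * pi)) \<subseteq> U"
    unfolding U_def using e by (auto intro: open_halfspace_Re_lt simp: in_cbox_complex_iff intro: le_less_trans[OF _ ln_less_zero])
  have holH: "H holomorphic_on U"
    unfolding H_def F_def
    by (intro holomorphic_intros holomorphic_on_compose_gen[OF _ hol, unfolded o_def])
       (auto simp: U_def)
  have dH: "norm (deriv H \<zeta>) = norm (G (exp \<zeta>)) / norm (exp \<zeta>)" if \<zeta>: "\<zeta> \<in> U" for \<zeta>
  proof -
    have "(p has_field_derivative deriv p (exp \<zeta>)) (at (exp \<zeta>))"
      using norm_exp[OF \<zeta>] by (intro holomorphic_derivI[OF hol]) auto
    from DERIV_chain2[where f = p, OF this DERIV_exp]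
    have "(H has_field_derivative (- (exp \<zeta> / (exp \<zeta>)\<^sup>2) + deriv p (exp \<zeta>) * exp \<zeta>)) (at \<zeta>)"
      unfolding H_def F_def
      by (auto intro!: derivative_eq_intros simp: power2_eq_square)
    hence "deriv H \<zeta> = - (exp \<zeta> / (exp \<zeta>)\<^sup>2) + deriv p (exp \<zeta>) * exp \<zeta>"
      by (rule DERIV_imp_deriv)
    also have "\<dots> = G (exp \<zeta>) / exp \<zeta>"
      by (simp add: G_def field_simps power2_eq_square)
    finally show ?thesis by (simp add: norm_divide)
  qed
  have box_U: "\<zeta> \<in> U" if "\<zeta> \<in> box (Complex (ln e) 0) (Complex (ln \<rho>) (2 * pi))" for \<zeta>
    using that U(2) box_subset_cbox by blast
  have box_norm: "e < norm (exp \<zeta>)" if "\<zeta> \<in> box (Complex (ln e) 0) (Complex (ln \<rho>) (2 * pi))" for \<zeta>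
  proof -
    have "exp (ln e) < exp (Re \<zeta>)" using that by (auto simp: exp_less_cancel_iff in_box_complex_iff simp del: exp_ln)
    thus ?thesis using e by simp
  qed
  \<comment> \<open>The box is open of height \<open>2 * pi\<close>; on the closed box
    \<open>exp\<close> would identify the two horizontal sides.\<close>
  have injH: "inj_on H (box (Complex (ln e) 0) (Complex (ln \<rho>) (2 * pi)))"
  proof (rule inj_onI)
    fix x y assume x: "x \<in> box (Complex (ln e) 0) (Complex (ln \<rho>) (2 * pi))"
      and y: "y \<in> box (Complex (ln e) 0) (Complex (ln \<rho>) (2 * pi))" and eq: "H x = H y"
    have "exp x = exp y"
    proof (rule inj_onD[OF inj])
      show "1 / exp x + p (exp x) = 1 / exp y + p (exp y)" using eq by (simp add: H_def F_def)
    qed (use norm_exp[OF box_U[OF x]] norm_exp[OF box_U[OF y]] in auto)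
    moreover have "\<bar>Im x - Im y\<bar> < 2 * pi"
      using x y by (auto simp: in_box_complex_iff abs_if)
    ultimately show "x = y" by (rule exp_complex_eqI[rotated])
  qed
  have boundH: "norm (H \<zeta> - c * cnj (H \<zeta>)) \<le> M"
    if "\<zeta> \<in> box (Complex (ln e) 0) (Complex (ln \<rho>) (2 * pi))" for \<zeta>
    unfolding H_def F_def
    by (rule image_outside_circle_bound[OF hol inj e(1) box_norm[OF that] norm_exp[OF box_U[OF that]] M])
  have M0: "0 \<le> M" using order_trans[OF norm_ge_zero M[of "of_real e"]] e by simp
  define J where "J = (\<lambda>s. integral {0..2*pi} (\<lambda>t. (norm (deriv H (Complex s t)))\<^sup>2))"
  have ln_le: "ln e \<le> ln \<rho>" using e by simp
  have area: "(1 - (norm c)\<^sup>2) * integral {ln e..ln \<rho>} J \<le> pi * M\<^sup>2"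
    unfolding J_def
    by (rule linear_conj_image_area[OF holH U ln_le _ injH c M0 boundH]) auto

  \<comment> \<open>\<open>\<psi>\<close> is the lower bound for \<open>J\<close> given by Bessel's inequality, and \<open>\<Psi>\<close> is its antiderivative\<close>
  define \<psi> where "\<psi> = (\<lambda>s::real. 2 * pi * (exp (- 2 * s) + (\<Sum>n<N. real n * a n * exp (real (2 * n) * s))))"
  define \<Psi> where "\<Psi> = (\<lambda>s::real. pi * (- exp (- 2 * s) + (\<Sum>n<N. a n * exp (real (2 * n) * s))))"
  have "(\<Psi> has_real_derivative \<psi> s) (at s within S)" for s S
    unfolding \<Psi>_def \<psi>_def
    by (auto intro!: derivative_eq_intros simp: sum_distrib_left sum_distrib_right algebra_simps)
  hence "(\<psi> has_integral (\<Psi> (ln \<rho>) - \<Psi> (ln e))) {ln e..ln \<rho>}"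
    using e by (intro fundamental_theorem_of_calculus) (auto simp: has_real_derivative_iff_has_vector_derivative)
  moreover have "J integrable_on {ln e..ln \<rho>}"
  proof -
    have "continuous_on (cbox (Complex (ln e) 0) (Complex (ln \<rho>) (2 * pi))) (deriv H)"
      using holomorphic_deriv[OF holH U(1)] U(2)
      by (meson holomorphic_on_imp_continuous_on continuous_on_subset)
    from continuous_on_Complex_cbox[OF this]
    have "continuous_on (cbox (ln e, 0) (ln \<rho>, 2 * pi)) (\<lambda>x. (norm (deriv H (Complex (fst x) (snd x))))\<^sup>2)"
      by (intro continuous_intros)
    from integral_integrable_2dim[OF this] show ?thesis
      by (simp add: J_def)
  qed
  moreover have "\<psi> s \<le> J s" if s: "s \<in> {ln e..ln \<rho>}" for s
  proof -
    define r where "r = exp s"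
    have r: "0 < r" "r < 1" using s e le_less_trans[of s "ln \<rho>" 0] by (auto simp: r_def)
    have holG: "G holomorphic_on ball 0 1"
      unfolding G_def by (intro holomorphic_intros holomorphic_deriv[OF hol]) auto
    have expG: "G has_fps_expansion fps_X ^ 2 * fps_deriv B - 1"
      unfolding G_def by (intro fps_expansion_intros B)
    have nth0: "fps_nth (fps_X ^ 2 * fps_deriv B - 1) 0 = -1"
      by (simp add: fps_X_power_mult_nth)
    \<comment> \<open>Differentiation lowers the index by one and \<open>z^2\<close> raises it by
      two. The degree 1 coefficient is therefore 0, and the constant term -1 comes from the
      pole.\<close>
    have nthSuc: "fps_nth (fps_X ^ 2 * fps_deriv B - 1) (Suc n) = of_nat n * fps_nth B n" for n
      by (cases n) (simp_all add: fps_X_power_mult_nth)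
    have "2 * pi * (1 + (\<Sum>n<N. real n * a n * r ^ (2 * Suc n))) =
            2 * pi * (\<Sum>k<Suc N. (norm (fps_nth (fps_X ^ 2 * fps_deriv B - 1) k))\<^sup>2 * r ^ (2 * k))"
      unfolding sum.lessThan_Suc_shift nth0 nthSuc
      by (simp add: a_def norm_mult power_mult_distrib power2_eq_square mult_ac)
    also have "\<dots> \<le> integral {0..2*pi} (\<lambda>t. (norm (G (of_real r * cis t)))\<^sup>2)"
      by (rule Bessel_circle[OF holG expG r])
    also have "\<dots> = r\<^sup>2 * J s"
    proof -
      have "(norm (deriv H (Complex s t)))\<^sup>2 = (norm (G (of_real r * cis t)))\<^sup>2 / r\<^sup>2" for t
      proof -
        have "exp (Complex s t) = of_real r * cis t"
          by (simp add: r_def exp_eq_polar exp_of_real)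
        moreover have "Complex s t \<in> U" using r by (simp add: U_def r_def)
        ultimately show ?thesis using dH[of "Complex s t"] by (simp add: power_divide r_def norm_mult)
      qed
      thus ?thesis using r by (simp add: J_def)
    qed
    finally have "2 * pi * (1 + (\<Sum>n<N. real n * a n * r ^ (2 * Suc n))) / r\<^sup>2 \<le> J s"
      using r by (simp add: divide_le_eq mult.commute)
    moreover have "\<psi> s = 2 * pi * (1 + (\<Sum>n<N. real n * a n * r ^ (2 * Suc n))) / r\<^sup>2"
    proof -
      have "exp (- 2 * s) = 1 / r\<^sup>2"
        by (simp add: r_def exp_minus inverse_eq_divide exp_double)
      moreover have "exp (real (2 * n) * s) = r ^ (2 * Suc n) / r\<^sup>2" for n :: nat
      proof -
        have "exp (real (2 * n) * s) = r ^ (2 * n)"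
          using exp_of_nat_mult[of "2 * n" s] by (simp add: r_def)
        thus ?thesis using r by (simp add: power2_eq_square)
      qed
      ultimately show ?thesis
        unfolding \<psi>_def by (simp add: distrib_left add_divide_distrib sum_divide_distrib sum_distrib_left mult.assoc del: mult_Suc_right)
    qed
    ultimately show ?thesis by simp
  qed
  ultimately have "\<Psi> (ln \<rho>) - \<Psi> (ln e) \<le> integral {ln e..ln \<rho>} J"
    using has_integral_le integrable_integral by blast
  moreover have "\<Psi> (ln x) = pi * (- (1 / x\<^sup>2) + (\<Sum>n<N. a n * x ^ (2 * n)))" if "0 < x" for x
  proof -
    have "exp (- 2 * ln x) = 1 / x\<^sup>2"
      using that by (simp add: exp_minus inverse_eq_divide exp_double)
    moreover have "exp (real (2 * n) * ln x) = x ^ (2 * n)" for n :: nat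
      using exp_of_nat_mult[of "2 * n" "ln x"] that by simp
    ultimately show ?thesis by (simp add: \<Psi>_def)
  qed
  ultimately have "pi * (1 / e\<^sup>2 - 1 / \<rho>\<^sup>2 + (\<Sum>n<N. a n * (\<rho> ^ (2 * n) - e ^ (2 * n)))) \<le> integral {ln e..ln \<rho>} J"
    using e by (simp add: right_diff_distrib sum_subtractf algebra_simps)
  hence "(1 - (norm c)\<^sup>2) * (pi * (1 / e\<^sup>2 - 1 / \<rho>\<^sup>2 + (\<Sum>n<N. a n * (\<rho> ^ (2 * n) - e ^ (2 * n))))) \<le> pi * M\<^sup>2"
    using c by (intro order_trans[OF mult_left_mono area]) (auto simp: abs_square_le_1)
  hence "pi * ((1 - (norm c)\<^sup>2) * (1 / e\<^sup>2 - 1 / \<rho>\<^sup>2 + (\<Sum>n<N. a n * (\<rho> ^ (2 * n) - e ^ (2 * n))))) \<le> pi * M\<^sup>2"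
    by (simp only: mult.left_commute)
  thus ?thesis by (simp add: a_def)
qed

section \<open>Shrinking the inner circle\<close>

text \<open>The second derivative is bounded on the compact disk of radius 1/2, and Taylor's theorem
  then makes the remainder uniform in \<open>z\<close>.\<close>

lemma quadratic_remainder_bound:
  fixes p :: "complex \<Rightarrow> complex"
  assumes hol: "p holomorphic_on ball 0 1"
  obtains C where "0 \<le> C" "\<And>z. norm z \<le> 1 / 2 \<Longrightarrow> norm (p z - p 0 - deriv p 0 * z) \<le> C * (norm z)\<^sup>2"
proof -
  have "continuous_on (cball 0 (1/2)) (deriv (deriv p))"
    by (intro holomorphic_on_imp_continuous_on holomorphic_on_subset[OF holomorphic_deriv[OF holomorphic_deriv[OF hol]]]) auto
  hence "compact (deriv (deriv p) ` cball 0 (1/2))"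
    by (intro compact_continuous_image) auto
  then obtain C where C: "\<And>z. z \<in> cball 0 (1/2) \<Longrightarrow> norm (deriv (deriv p) z) \<le> C"
    using compact_imp_bounded bounded_iff by (metis imageI)
  have "norm (p z - p 0 - deriv p 0 * z) \<le> C * (norm z)\<^sup>2" if z: "norm z \<le> 1 / 2" for z
  proof -
    have "((deriv ^^ i) p has_field_derivative (deriv ^^ Suc i) p x) (at x within cball 0 (1/2))"
      if "x \<in> cball 0 (1/2)" for x i
    proof -
      have "(deriv ^^ i) p holomorphic_on ball 0 1" by (rule holomorphic_higher_deriv[OF hol]) auto
      from holomorphic_derivI[OF this, of x] that show ?thesis
        by (auto intro: has_field_derivative_at_within)
    qed
    from complex_Taylor[of "cball 0 (1/2)" 1 "\<lambda>i. (deriv ^^ i) p" C 0 z, OF _ this] C z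
    show ?thesis by (simp add: numeral_2_eq_2 algebra_simps)
  qed
  moreover have "0 \<le> C" using order_trans[OF norm_ge_zero C[of 0]] by simp
  ultimately show ?thesis using that by blast
qed

text \<open>With \<open>c = \<beta> e^2\<close> and \<open>b = p 0\<close> the divergent terms
  \<open>1/e^2\<close> of the annulus inequality cancel, so the limits in \<open>e\<close> and then
  \<open>\<rho>\<close> exist. This is Gronwall's area theorem, stated for partial sums.\<close>

theorem area_theorem:
  fixes p :: "complex \<Rightarrow> complex" and B :: "complex fps"
  assumes hol: "p holomorphic_on ball 0 1" and B: "p has_fps_expansion B"
    and inj: "inj_on (\<lambda>z. 1 / z + p z) (ball 0 1 - {0})"
  shows "(\<Sum>n<N. n * (norm (fps_nth B n))\<^sup>2) \<le> 1"
proof -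
  define \<beta> where "\<beta> = deriv p 0"
  define a where "a n = real n * (norm (fps_nth B n))\<^sup>2" for n
  obtain C where C: "0 \<le> C" "\<And>z. norm z \<le> 1 / 2 \<Longrightarrow> norm (p z - p 0 - \<beta> * z) \<le> C * (norm z)\<^sup>2"
    using quadratic_remainder_bound[OF hol] unfolding \<beta>_def by blast
  \<comment> \<open>\<open>C\<close> comes from the remainder itself, the product from the
    conjugated part, where \<open>norm z \<le> 1\<close> is used.\<close>
  define K where "K = C + norm \<beta> * (norm \<beta> + C)"
  have circle: "norm (1 / z + p z - p 0 - \<beta> * e\<^sup>2 * cnj (1 / z + p z - p 0)) \<le> 1 / e + K * e\<^sup>2"
    if z: "norm z = e" and e: "0 < e" "e < 1 / 2" for z e
  proof -
    define R where "R = p z - p 0 - \<beta> * z"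
    have R: "norm R \<le> C * e\<^sup>2" unfolding R_def using C(2)[of z] that by simp
    \<comment> \<open>On the circle \<open>e^2 * cnj (1 / z) = z\<close>, so the correction term
      removes exactly the linear part \<open>\<beta> * z\<close>.\<close>
    have "of_real (e\<^sup>2) * cnj (1 / z) = z"
      unfolding z[symmetric] complex_norm_square using z e by auto
    hence "\<beta> * (of_real (e\<^sup>2) * cnj (1 / z)) = \<beta> * z" by simp
    hence "1 / z + p z - p 0 - \<beta> * e\<^sup>2 * cnj (1 / z + p z - p 0) =
           1 / z + (R - \<beta> * e\<^sup>2 * cnj (\<beta> * z + R))"
      by (simp add: R_def algebra_simps)
    also have "norm \<dots> \<le> 1 / e + (C * e\<^sup>2 + norm \<beta> * e\<^sup>2 * (norm \<beta> * 1 + C * 1))"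
    proof (intro norm_triangle_le add_mono order_trans[OF norm_triangle_ineq4])
      show "norm (1 / z) \<le> 1 / e" using z by (simp add: norm_divide)
      have "norm (cnj (\<beta> * z + R)) \<le> norm \<beta> * norm z + norm R"
        unfolding complex_mod_cnj by (rule norm_triangle_le) (simp add: norm_mult)
      also have "\<dots> \<le> norm \<beta> * 1 + C * 1"
        using R z e C(1) by (intro add_mono mult_left_mono order_trans[OF R]) (auto simp: power_le_one)
      finally show "norm (\<beta> * e\<^sup>2 * cnj (\<beta> * z + R)) \<le> norm \<beta> * e\<^sup>2 * (norm \<beta> * 1 + C * 1)"
        unfolding norm_mult by (intro mult_mono) (auto simp: norm_power)
    qed (rule R)
    also have "\<dots> = 1 / e + K * e\<^sup>2" by (simp add: K_def algebra_simps)
    finally show ?thesis .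
  qed
  \<comment> \<open>Both sides have lost their \<open>1 / e^2\<close>; what remains on the right
    tends to 0 with \<open>e\<close>.\<close>
  have ineq: "(1 - (norm \<beta> * e\<^sup>2)\<^sup>2) * (- (1 / \<rho>\<^sup>2) + (\<Sum>n<N. a n * (\<rho> ^ (2 * n) - e ^ (2 * n)))) \<le>
      2 * K * e + K\<^sup>2 * e ^ 4 + (norm \<beta>)\<^sup>2 * e\<^sup>2"
    if e: "0 < e" "e < 1 / 2" "e < \<rho>" "norm \<beta> * e\<^sup>2 < 1" and \<rho>: "\<rho> < 1" for e \<rho>
  proof -
    have nc: "norm (\<beta> * e\<^sup>2) = norm \<beta> * e\<^sup>2" by (simp add: norm_mult norm_power)
    from annulus_area_inequality[OF hol B inj e(1,3) \<rho>, of "\<beta> * e\<^sup>2" "p 0" "1 / e + K * e\<^sup>2" N]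
    have "(1 - (norm \<beta> * e\<^sup>2)\<^sup>2) * (1 / e\<^sup>2 - 1 / \<rho>\<^sup>2 + (\<Sum>n<N. a n * (\<rho> ^ (2 * n) - e ^ (2 * n)))) \<le> (1 / e + K * e\<^sup>2)\<^sup>2"
      unfolding nc a_def using circle e by blast
    moreover have "(1 / e + K * e\<^sup>2)\<^sup>2 = 1 / e\<^sup>2 + 2 * K * e + K\<^sup>2 * e ^ 4"
      using e by (simp add: field_simps power2_eq_square eval_nat_numeral)
    moreover have "(1 - (norm \<beta> * e\<^sup>2)\<^sup>2) * (1 / e\<^sup>2) = 1 / e\<^sup>2 - (norm \<beta>)\<^sup>2 * e\<^sup>2"
      using e by (simp add: field_simps power2_eq_square eval_nat_numeral)
    ultimately show ?thesis by (simp add: algebra_simps)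
  qed
  have rho: "- (1 / \<rho>\<^sup>2) + (\<Sum>n<N. a n * \<rho> ^ (2 * n)) \<le> 0" if \<rho>: "0 < \<rho>" "\<rho> < 1" for \<rho>
  proof -
    have l1: "((\<lambda>e. (1 - (norm \<beta> * e\<^sup>2)\<^sup>2) * (- (1 / \<rho>\<^sup>2) + (\<Sum>n<N. a n * (\<rho> ^ (2 * n) - e ^ (2 * n)))))
        \<longlongrightarrow> (1 - (norm \<beta> * 0\<^sup>2)\<^sup>2) * (- (1 / \<rho>\<^sup>2) + (\<Sum>n<N. a n * (\<rho> ^ (2 * n) - 0 ^ (2 * n))))) (at_right 0)"
      by (intro tendsto_intros)
    have l2: "((\<lambda>e. 2 * K * e + K\<^sup>2 * e ^ 4 + (norm \<beta>)\<^sup>2 * e\<^sup>2)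
        \<longlongrightarrow> 2 * K * 0 + K\<^sup>2 * 0 ^ 4 + (norm \<beta>)\<^sup>2 * 0\<^sup>2) (at_right 0)"
      by (intro tendsto_intros)
    have l3: "eventually (\<lambda>e. (1 - (norm \<beta> * e\<^sup>2)\<^sup>2) * (- (1 / \<rho>\<^sup>2) + (\<Sum>n<N. a n * (\<rho> ^ (2 * n) - e ^ (2 * n))))
        \<le> 2 * K * e + K\<^sup>2 * e ^ 4 + (norm \<beta>)\<^sup>2 * e\<^sup>2) (at_right 0)"
    proof -
      have "((\<lambda>e. norm \<beta> * e\<^sup>2) \<longlongrightarrow> norm \<beta> * 0\<^sup>2) (at_right 0)" by (intro tendsto_intros)
      hence "eventually (\<lambda>e. norm \<beta> * e\<^sup>2 < 1) (at_right (0::real))"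
        by (rule order_tendstoD) simp
      moreover have "eventually (\<lambda>e. e \<in> {0<..<min (1/2) \<rho>}) (at_right (0::real))"
        using \<rho> by (intro eventually_at_right_real) auto
      ultimately show ?thesis
        by eventually_elim (rule ineq, use \<rho> in auto)
    qed
    have "(1 - (norm \<beta> * 0\<^sup>2)\<^sup>2) * (- (1 / \<rho>\<^sup>2) + (\<Sum>n<N. a n * (\<rho> ^ (2 * n) - 0 ^ (2 * n))))
        \<le> 2 * K * 0 + K\<^sup>2 * 0 ^ 4 + (norm \<beta>)\<^sup>2 * 0\<^sup>2"
      by (rule tendsto_le[OF trivial_limit_at_right_real l2 l1 l3])
    \<comment> \<open>For \<open>n = 0\<close> the power \<open>0 ^ (2 * n)\<close> is 1, but then
      \<open>a 0 = 0\<close>.\<close>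
    moreover have "a n * (\<rho> ^ (2 * n) - 0 ^ (2 * n)) = a n * \<rho> ^ (2 * n)" for n
      by (cases "n = 0") (simp_all add: a_def)
    ultimately show ?thesis by simp
  qed
  have "((\<lambda>\<rho>. - (1 / \<rho>\<^sup>2) + (\<Sum>n<N. a n * \<rho> ^ (2 * n))) \<longlongrightarrow> - (1 / 1\<^sup>2) + (\<Sum>n<N. a n * 1 ^ (2 * n))) (at_left (1::real))"
    by (intro tendsto_intros) auto
  moreover have "eventually (\<lambda>\<rho>. - (1 / \<rho>\<^sup>2) + (\<Sum>n<N. a n * \<rho> ^ (2 * n)) \<le> 0) (at_left (1::real))"
    using eventually_at_left_real[of 0 "1::real"] by (rule eventually_mono) (use rho in auto)
  ultimately have "- (1 / 1\<^sup>2) + (\<Sum>n<N. a n * 1 ^ (2 * n)) \<le> 0"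
    by (rule tendsto_upperbound) (rule trivial_limit_at_left_real)
  thus ?thesis by (simp add: a_def)
qed

section \<open>The bounding function\<close>

text \<open>Multiplying the derivative by its conjugate expression clears the square root, so its
  sign on \<open>[0, 1)\<close> is that of a cubic in \<open>x^2\<close>.\<close>

lemma bound_fun_has_derivative:
  assumes "0 \<le> x" "x < 1"
  obtains k where "0 < k"
    "(bound_fun has_real_derivative k * (5 + 21 * x\<^sup>2 + 15 * x ^ 4 - 45 * x ^ 6)) (at x)"
proof -
  have x2: "x\<^sup>2 < 1" using assms by (simp add: abs_square_less_1)
  define q where "q = sqrt (1 - x\<^sup>2)"
  define s where "s = sqrt 5 * q"
  have s: "0 < s" "s\<^sup>2 = 5 * (1 - x\<^sup>2)"
    using x2 by (auto simp: s_def q_def power_mult_distrib)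
  define k where "k = 1 / (s * ((1 + 3 * x\<^sup>2) * s + 2 * x))"
  have pos: "0 < (1 + 3 * x\<^sup>2) * s + 2 * x"
    using s(1) assms by (intro add_pos_nonneg mult_pos_pos) (auto simp: add_pos_nonneg)
  have "((1 + 3 * x\<^sup>2) * s - 2 * x) * ((1 + 3 * x\<^sup>2) * s + 2 * x) = (1 + 3 * x\<^sup>2)\<^sup>2 * s\<^sup>2 - 4 * x\<^sup>2"
    by (simp add: algebra_simps power2_eq_square)
  also have "\<dots> = 5 + 21 * x\<^sup>2 + 15 * x ^ 4 - 45 * x ^ 6"
    unfolding s(2) by algebra
  finally have "k * (5 + 21 * x\<^sup>2 + 15 * x ^ 4 - 45 * x ^ 6) = ((1 + 3 * x\<^sup>2) * s - 2 * x) / s"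
    using pos s(1) by (simp add: k_def divide_simps)
  also have "\<dots> = 1 + 3 * x\<^sup>2 - 2 * x / s"
    using s(1) by (simp add: field_simps)
  also have "2 * x / s = 2 / sqrt 5 * (x / q)" by (simp add: s_def)
  finally have eq: "k * (5 + 21 * x\<^sup>2 + 15 * x ^ 4 - 45 * x ^ 6) = 1 + 3 * x\<^sup>2 - 2 / sqrt 5 * (x / q)" .
  have "(bound_fun has_real_derivative (1 + 3 * x\<^sup>2 - 2 / sqrt 5 * (x / q))) (at x)"
  proof -
    have "((\<lambda>x. sqrt (1 - x\<^sup>2)) has_real_derivative - (x / q)) (at x)"
    proof -
      have "((\<lambda>x. 1 - x\<^sup>2) has_real_derivative - (2 * x)) (at x)"
        by (auto intro!: derivative_eq_intros)
      moreover have "DERIV sqrt (1 - x\<^sup>2) :> inverse q / 2"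
        unfolding q_def by (rule DERIV_real_sqrt) (use x2 in simp)
      ultimately have "((\<lambda>x. sqrt (1 - x\<^sup>2)) has_real_derivative inverse q / 2 * - (2 * x)) (at x)"
        by (rule DERIV_chain2[where f = sqrt, rotated])
      moreover have "inverse q / 2 * - (2 * x) = - (x / q)"
        by (simp add: inverse_eq_divide)
      ultimately show ?thesis by (simp only:)
    qed
    from DERIV_add[OF DERIV_add[OF DERIV_ident DERIV_pow[of 3]] DERIV_cmult[OF this, of "2 / sqrt 5"]]
    show ?thesis unfolding bound_fun_def[abs_def] by simp
  qed
  moreover have "0 < k" using s(1) pos by (simp add: k_def)
  ultimately show ?thesis by (intro that[of k]) (simp_all only: eq)
qed

lemma bound_fun_less_left:
  assumes "0 \<le> x" "x < 0.974"
  shows "bound_fun x < bound_fun 0.974"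
proof (rule DERIV_pos_imp_increasing[where f = bound_fun])
  fix y :: real assume y: "x \<le> y" "y \<le> 0.974"
  define c u where "c = (0.974\<^sup>2 :: real)" and "u = y\<^sup>2"
  have u: "0 \<le> u" "u \<le> c" unfolding u_def c_def using y assms by (auto intro!: power_mono)
  have cv: "c = 0.948676" by (simp add: c_def power2_eq_square)
  \<comment> \<open>At this \<open>c\<close> every coefficient of the second factor is positive, so
    the cubic is smallest on \<open>[0, c]\<close> at \<open>c\<close>, where it is still
    positive.\<close>
  have "0 \<le> (c - u) * ((45 * c\<^sup>2 - 15 * c - 21) + (45 * c - 15) * u + 45 * u\<^sup>2)"
    using u by (intro mult_nonneg_nonneg add_nonneg_nonneg) (simp_all add: cv power2_eq_square)
  also have "\<dots> = 5 + 21 * u + 15 * u\<^sup>2 - 45 * u ^ 3 - (5 + 21 * c + 15 * c\<^sup>2 - 45 * c ^ 3)"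
    by algebra
  finally have "5 + 21 * c + 15 * c\<^sup>2 - 45 * c ^ 3 \<le> 5 + 21 * u + 15 * u\<^sup>2 - 45 * u ^ 3"
    by simp
  moreover have "5 + 21 * c + 15 * c\<^sup>2 - 45 * c ^ 3 > 0"
    by (simp add: cv power2_eq_square power3_eq_cube)
  ultimately have pos: "5 + 21 * y\<^sup>2 + 15 * y ^ 4 - 45 * y ^ 6 > 0" by (simp add: u_def flip: power_mult)
  have "0 \<le> y" "y < 1" using y assms by auto
  then obtain k where k: "0 < k" "(bound_fun has_real_derivative k * (5 + 21 * y\<^sup>2 + 15 * y ^ 4 - 45 * y ^ 6)) (at y)"
    by (rule bound_fun_has_derivative)
  show "\<exists>d. (bound_fun has_real_derivative d) (at y) \<and> 0 < d"
    by (intro exI conjI) (rule k(2), rule mult_pos_pos[OF k(1) pos])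
qed (use assms in auto)

text \<open>The cubic is already negative at \<open>0.97405^2\<close> and stays below that value
  beyond it. As 0.97405 is below 0.9741, the maximizer gets a strict upper bound.\<close>

lemma bound_fun_less_right:
  assumes "0.97405 < x" "x \<le> 1"
  shows "bound_fun x < bound_fun 0.97405"
\<comment> \<open>The square root is not differentiable at \<open>x = 1\<close>, hence derivatives
  in the open interval and continuity at its ends.\<close>
proof (rule DERIV_neg_imp_decreasing_open[where f = bound_fun])
  fix y :: real assume y: "0.97405 < y" "y < x"
  define c u where "c = (0.97405\<^sup>2 :: real)" and "u = y\<^sup>2"
  have cv: "c = 0.9487734025" by (simp add: c_def power2_eq_square)
  have "c \<le> u" unfolding u_def c_def using y by (intro power_mono) auto
  moreover have "0 \<le> u" by (simp add: u_def)
  ultimately have "0 \<le> (u - c) * ((45 * c\<^sup>2 - 15 * c - 21) + (45 * c - 15) * u + 45 * u\<^sup>2)"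
    by (intro mult_nonneg_nonneg add_nonneg_nonneg) (simp_all add: cv power2_eq_square)
  also have "\<dots> = (5 + 21 * c + 15 * c\<^sup>2 - 45 * c ^ 3) - (5 + 21 * u + 15 * u\<^sup>2 - 45 * u ^ 3)"
    by algebra
  finally have "5 + 21 * c + 15 * c\<^sup>2 - 45 * c ^ 3 \<ge> 5 + 21 * u + 15 * u\<^sup>2 - 45 * u ^ 3"
    by simp
  moreover have "5 + 21 * c + 15 * c\<^sup>2 - 45 * c ^ 3 < 0"
    by (simp add: cv power2_eq_square power3_eq_cube)
  ultimately have neg: "5 + 21 * y\<^sup>2 + 15 * y ^ 4 - 45 * y ^ 6 < 0" by (simp add: u_def flip: power_mult)
  have "0 \<le> y" "y < 1" using y assms by auto
  then obtain k where k: "0 < k" "(bound_fun has_real_derivative k * (5 + 21 * y\<^sup>2 + 15 * y ^ 4 - 45 * y ^ 6)) (at y)"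
    by (rule bound_fun_has_derivative)
  show "\<exists>d. (bound_fun has_real_derivative d) (at y) \<and> d < 0"
    by (intro exI conjI) (rule k(2), rule mult_pos_neg[OF k(1) neg])
next
  show "continuous_on {0.97405..x} bound_fun"
    unfolding bound_fun_def[abs_def] by (intro continuous_intros)
qed (use assms in auto)

lemma bound_fun_lower: "2.10064 \<le> bound_fun 0.974"
proof -
  \<comment> \<open>Both decimals are the true values rounded down, checked by squaring.\<close>
  have "0.226548 \<le> sqrt (1 - 0.974\<^sup>2 :: real)"
    by (rule real_le_rsqrt) (simp add: power2_eq_square)
  moreover have "0.894427 \<le> 2 / sqrt (5::real)"
  proof -
    have "sqrt 5 \<le> (2 / 0.894427 :: real)" by (rule real_le_lsqrt) (simp_all add: power2_eq_square)
    thus ?thesis by (simp add: field_simps)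
  qed
  ultimately have "0.894427 * 0.226548 \<le> 2 / sqrt 5 * sqrt (1 - 0.974\<^sup>2 :: real)"
    by (intro mult_mono) auto
  thus ?thesis by (simp add: bound_fun_def power3_eq_cube)
qed

lemma bound_fun_upper:
  assumes x: "0.974 \<le> x" "x \<le> 0.9741"
  shows "bound_fun x < 2.10065"
proof -
  define t where "t = x - 0.974"
  have t: "0 \<le> t" "t \<le> 0.0001" and xt: "x = 0.974 + t" using x by (auto simp: t_def)
  have "x\<^sup>2 \<le> 0.9741\<^sup>2" using x by (intro power_mono) auto
  hence nn: "0 \<le> 1 - x\<^sup>2" by (simp add: power2_eq_square)
  \<comment> \<open>The AM-GM inequality is the tangent bound for the square root, based at 0.2265,
    close to \<open>sqrt (1 - 0.974^2)\<close>. Here 2.20751 is \<open>1 / (2 * 0.2265)\<close>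
    rounded up and 0.11325 is half of 0.2265.\<close>
  have sq: "sqrt (1 - x\<^sup>2) \<le> (1 - x\<^sup>2) * 2.20751 + 0.11325"
  proof -
    have "(1 - x\<^sup>2) / 0.2265 * 0.2265 = 1 - x\<^sup>2" by simp
    moreover have "sqrt ((1 - x\<^sup>2) / 0.2265 * 0.2265) \<le> ((1 - x\<^sup>2) / 0.2265 + 0.2265) / 2"
      by (rule arith_geo_mean_sqrt) (use nn in auto)
    moreover have "((1 - x\<^sup>2) / 0.2265 + 0.2265) / 2 \<le> (1 - x\<^sup>2) * 2.20751 + 0.11325"
      using nn by simp
    ultimately show ?thesis by (simp only:)
  qed
  have "2 / sqrt 5 \<le> (0.894428 :: real)"
  proof -
    have "2 / 0.894428 \<le> sqrt (5::real)" by (rule real_le_rsqrt) (simp add: power2_eq_square)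
    thus ?thesis by (simp add: field_simps)
  qed
  hence "2 / sqrt 5 * sqrt (1 - x\<^sup>2) \<le> 0.894428 * ((1 - x\<^sup>2) * 2.20751 + 0.11325)"
    using sq nn by (intro mult_mono) auto
  moreover have "x\<^sup>2 = 0.948676 + 1.948 * t + t\<^sup>2"
    unfolding xt power2_sum by (simp add: power2_eq_square)
  moreover have "x ^ 3 = 0.924010424 + 2.846028 * t + 2.922 * t\<^sup>2 + t ^ 3"
  proof -
    have "(a + t) ^ 3 = a ^ 3 + 3 * a\<^sup>2 * t + 3 * a * t\<^sup>2 + t ^ 3" for a by algebra
    thus ?thesis unfolding xt by (simp add: power2_eq_square power3_eq_cube)
  qed
  moreover have "t\<^sup>2 \<le> 0.0001\<^sup>2" "t ^ 3 \<le> 0.0001 ^ 3" "0 \<le> t\<^sup>2"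
    using t by (auto intro!: power_mono)
  hence "t\<^sup>2 \<le> 0.00000001" "t ^ 3 \<le> 0.000000000001" "0 \<le> t\<^sup>2"
    by (simp_all add: power2_eq_square power3_eq_cube)
  \<comment> \<open>Variables replace the powers and the square root term, which leaves a linear
    arithmetic problem.\<close>
  moreover have "x + c + q < 2.10065"
    if "q \<le> 0.894428 * ((1 - b) * 2.20751 + 0.11325)" "b = 0.948676 + 1.948 * t + s"
      "c = 0.924010424 + 2.846028 * t + 2.922 * s + w" "s \<le> 0.00000001" "w \<le> 0.000000000001" "0 \<le> s"
    for b c q s w :: real
    using that t unfolding xt by (simp add: field_simps)
  ultimately show ?thesis
    unfolding bound_fun_def by blast
qed

text \<open>Compactness gives a maximizer, strict monotonicity on both sides confines it to
  \<open>[0.974, 0.97405]\<close>, and the numerical bounds apply there.\<close>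

lemma bound_fun_maximizer:
  obtains x where "x \<in> {0.974..<0.9741}" "\<forall>y\<in>{0..1}. bound_fun y \<le> bound_fun x"
    "2.10064 \<le> bound_fun x" "bound_fun x < 2.10065"
proof -
  have "continuous_on {0..1} bound_fun"
    unfolding bound_fun_def[abs_def] by (intro continuous_intros)
  then obtain x where x: "x \<in> {0..1}" "\<And>y. y \<in> {0..1} \<Longrightarrow> bound_fun y \<le> bound_fun x"
    using continuous_attains_sup[of "{0..1::real}" bound_fun] by auto
  have "0.974 \<le> x"
  proof (rule ccontr)
    assume "\<not> ?thesis"
    hence "bound_fun x < bound_fun 0.974" using x(1) by (intro bound_fun_less_left) auto
    moreover have "bound_fun 0.974 \<le> bound_fun x" by (rule x(2)) simp
    ultimately show False by (rule less_le_not_le[THEN iffD1, THEN conjunct2, THEN notE])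
  qed
  moreover have "x \<le> 0.97405"
  proof (rule ccontr)
    assume "\<not> ?thesis"
    hence "bound_fun x < bound_fun 0.97405" using x(1) by (intro bound_fun_less_right) auto
    moreover have "bound_fun 0.97405 \<le> bound_fun x" by (rule x(2)) simp
    ultimately show False by (rule less_le_not_le[THEN iffD1, THEN conjunct2, THEN notE])
  qed
  moreover have "2.10064 \<le> bound_fun x"
    by (rule order_trans[OF bound_fun_lower x(2)]) simp
  ultimately show ?thesis
    using x bound_fun_upper[of x] by (intro that[of x]) auto
qed

section \<open>The coefficient estimate\<close>

text \<open>The singularity of the quotient at 0 is removable. This yields \<open>\<phi>\<close>
  from \<open>f\<close> and the regular parts to which the area theorem is applied.\<close>

lemma holomorphic_difference_quotient:
  fixes g :: "complex \<Rightarrow> complex" and G :: "complex fps"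
  assumes hol: "g holomorphic_on ball 0 1" and G: "g has_fps_expansion G"
  obtains q where "q holomorphic_on ball 0 1" "q has_fps_expansion fps_shift 1 G" "\<And>z. g z = g 0 + z * q z"
proof -
  define q where "q = (\<lambda>z. if z = 0 then deriv g 0 else (g z - g 0) / (z - 0))"
  have hq: "q holomorphic_on ball 0 1"
    unfolding q_def by (rule pole_lemma[OF hol]) simp
  have g_eq: "g z = g 0 + z * q z" for z by (simp add: q_def)
  have Q: "q has_fps_expansion fps_expansion q 0"
    by (rule has_fps_expansion_fps_expansion[OF _ _ hq]) auto
  have "(\<lambda>z. g 0 + z * q z) has_fps_expansion fps_const (g 0) + fps_X * fps_expansion q 0"
    by (intro fps_expansion_intros Q)
  hence "g has_fps_expansion fps_const (g 0) + fps_X * fps_expansion q 0"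
    by (simp only: g_eq[symmetric])
  hence "G = fps_const (g 0) + fps_X * fps_expansion q 0"
    by (rule fps_expansion_unique_complex[OF G])
  hence "fps_expansion q 0 = fps_shift 1 G"
    by (simp add: fps_eq_iff)
  with Q have "q has_fps_expansion fps_shift 1 G" by (simp only:)
  from that[OF hq this g_eq] show ?thesis .
qed

lemma fps_mult_nth_upto_3:
  fixes A B :: "'a::comm_semiring_1 fps"
  shows "fps_nth (A * B) 0 = fps_nth A 0 * fps_nth B 0"
    "fps_nth (A * B) 1 = fps_nth A 0 * fps_nth B 1 + fps_nth A 1 * fps_nth B 0"
    "fps_nth (A * B) 2 = fps_nth A 0 * fps_nth B 2 + fps_nth A 1 * fps_nth B 1 + fps_nth A 2 * fps_nth B 0"
    "fps_nth (A * B) 3 = fps_nth A 0 * fps_nth B 3 + fps_nth A 1 * fps_nth B 2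
       + fps_nth A 2 * fps_nth B 1 + fps_nth A 3 * fps_nth B 0"
  by (simp_all add: fps_mult_nth eval_nat_numeral)

lemma univalent_coefficient_bound:
  fixes f :: "complex \<Rightarrow> complex" and F :: "complex fps"
  assumes hol: "f holomorphic_on ball 0 1" and F: "f has_fps_expansion F"
    and F01: "fps_nth F 0 = 0" "fps_nth F 1 = 1" and inj: "inj_on f (ball 0 1)"
  shows "\<exists>x\<in>{0..1}. norm (fps_nth F 2 * fps_nth F 3 - fps_nth F 4) \<le> bound_fun x"
proof -
  have f0: "f 0 = 0" using has_fps_expansion_imp_0_eq_fps_nth_0[OF F] F01 by simp
  obtain \<phi> where \<phi>: "\<phi> holomorphic_on ball 0 1" "\<phi> has_fps_expansion fps_shift 1 F" "\<And>z. f z = z * \<phi> z"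
    using holomorphic_difference_quotient[OF hol F] unfolding f0 by auto
  have \<phi>0: "\<phi> 0 = 1" using has_fps_expansion_imp_0_eq_fps_nth_0[OF \<phi>(2)] F01 by simp
  have \<phi>nz: "\<phi> z \<noteq> 0" if "z \<in> ball 0 1" for z
  proof (cases "z = 0")
    case False
    have "f z \<noteq> f 0" using inj_onD[OF inj, of z 0] that False by auto
    thus ?thesis using \<phi>(3)[of z] f0 by auto
  qed (simp add: \<phi>0)
  have "(\<lambda>z. 1 / \<phi> z) holomorphic_on ball 0 1"
    using \<phi>nz by (intro holomorphic_intros \<phi>) auto
  moreover have "contractible (ball (0::complex) 1)"
    by (rule convex_imp_contractible) simp
  ultimately obtain \<psi>0 where \<psi>0: "\<psi>0 holomorphic_on ball 0 1" "\<And>z. z \<in> ball 0 1 \<Longrightarrow> 1 / \<phi> z = \<psi>0 z ^ 2"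
    by (rule contractible_imp_holomorphic_sqrt) (use \<phi>nz in simp_all)
  \<comment> \<open>The factor \<open>\<psi>0 0\<close> is 1 or -1 and selects the root with value 1
    at 0.\<close>
  define \<psi> where "\<psi> z = \<psi>0 0 * \<psi>0 z" for z
  have \<psi>00: "\<psi>0 0 ^ 2 = 1" using \<psi>0(2)[of 0] \<phi>0 by simp
  have \<psi>hol: "\<psi> holomorphic_on ball 0 1" unfolding \<psi>_def[abs_def] by (intro holomorphic_intros \<psi>0)
  have \<psi>_0: "\<psi> 0 = 1" using \<psi>00 by (simp add: \<psi>_def power2_eq_square)
  have \<psi>sq: "\<phi> z * (\<psi> z)\<^sup>2 = 1" if "z \<in> ball 0 1" for z
    using \<psi>0(2)[OF that] \<phi>nz[OF that] \<psi>00 by (simp add: \<psi>_def power_mult_distrib field_simps)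
  define \<Psi> where "\<Psi> = fps_expansion \<psi> 0"
  have \<Psi>: "\<psi> has_fps_expansion \<Psi>"
    unfolding \<Psi>_def by (rule has_fps_expansion_fps_expansion[OF _ _ \<psi>hol]) auto
  define D where "D = \<Psi> * \<Psi>"
  have D: "(\<lambda>z. (\<psi> z)\<^sup>2) has_fps_expansion D"
    unfolding D_def power2_eq_square by (intro fps_expansion_intros \<Psi>)
  have D1: "fps_shift 1 F * D = 1"
  proof (rule fps_expansion_unique_complex)
    show "(\<lambda>z. \<phi> z * (\<psi> z)\<^sup>2) has_fps_expansion fps_shift 1 F * D"
      by (intro has_fps_expansion_mult \<phi> D)
    have "eventually (\<lambda>z. z \<in> ball 0 1) (nhds (0::complex))"
      by (intro eventually_nhds_in_open) auto
    hence "eventually (\<lambda>z. \<phi> z * (\<psi> z)\<^sup>2 = 1) (nhds 0)"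
      by eventually_elim (rule \<psi>sq)
    thus "(\<lambda>z. \<phi> z * (\<psi> z)\<^sup>2) has_fps_expansion 1"
      by (subst has_fps_expansion_cong[OF _ refl]) auto
  qed
  define c where "c = fps_nth \<Psi>"
  have c0: "c 0 = 1" using has_fps_expansion_imp_0_eq_fps_nth_0[OF \<Psi>] \<psi>_0 by (simp add: c_def)

  have recip: "(\<psi> z)\<^sup>2 / z = 1 / f z" if "z \<in> ball 0 1 - {0}" for z
    using \<psi>sq[of z] that \<phi>nz[of z] by (simp add: \<phi>(3) field_simps)
  have D2: "norm (fps_nth D 2) \<le> 1"
  proof -
    have "(\<lambda>z. (\<psi> z)\<^sup>2) holomorphic_on ball 0 1" by (intro holomorphic_intros \<psi>hol)
    then obtain p where p: "p holomorphic_on ball 0 1" "p has_fps_expansion fps_shift 1 D"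
        "\<And>z. (\<psi> z)\<^sup>2 = 1 + z * p z"
      using holomorphic_difference_quotient[OF _ D] by (auto simp: \<psi>_0)
    have eq: "1 / z + p z = 1 / f z" if "z \<in> ball 0 1 - {0}" for z
      unfolding recip[OF that, symmetric] p(3) using that by (simp add: field_simps)
    have "inj_on (\<lambda>z. 1 / z + p z) (ball 0 1 - {0})"
      by (rule inj_onI) (use inj_onD[OF inj] in \<open>simp add: eq\<close>)
    \<comment> \<open>Only the term of index 1 survives, and the shift makes its coefficient the one
      of index 2 in \<open>D\<close>.\<close>
    from area_theorem[OF p(1,2) this, of 2]
    have "(norm (fps_nth D 2))\<^sup>2 \<le> 1" by (simp add: numeral_2_eq_2)
    thus ?thesis by (simp add: abs_square_le_1)
  qed
  have c13: "(norm (c 1))\<^sup>2 + 5 * (norm (c 3))\<^sup>2 \<le> 1"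
  proof -
    obtain \<kappa> where \<kappa>: "\<kappa> holomorphic_on ball 0 1" "\<kappa> has_fps_expansion fps_shift 1 \<Psi>" "\<And>z. \<psi> z = 1 + z * \<kappa> z"
      using holomorphic_difference_quotient[OF \<psi>hol \<Psi>] by (auto simp: \<psi>_0)
    define p where "p z = z * \<kappa> (z ^ 2)" for z
    have sq: "z ^ 2 \<in> ball 0 1" if "z \<in> ball 0 1" for z :: complex
      using that by (simp add: norm_power abs_square_less_1)
    have hp: "p holomorphic_on ball 0 1"
      unfolding p_def[abs_def]
      by (intro holomorphic_intros holomorphic_on_compose_gen[OF _ \<kappa>(1), unfolded o_def]) (use sq in auto)
    have P: "p has_fps_expansion fps_X * (fps_shift 1 \<Psi> oo fps_X ^ 2)"
      unfolding p_def[abs_def]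
      by (intro has_fps_expansion_mult has_fps_expansion_fps_X
           has_fps_expansion_compose[OF \<kappa>(2) has_fps_expansion_fps_X_power, unfolded o_def]) auto
    have eq: "1 / z + p z = \<psi> (z ^ 2) / z" if "z \<noteq> 0" for z
      using that by (simp add: p_def \<kappa>(3) field_simps power2_eq_square)
    have injp: "inj_on (\<lambda>z. 1 / z + p z) (ball 0 1 - {0})"
    proof (rule inj_onI)
      fix z w assume z: "z \<in> ball 0 1 - {0}" and w: "w \<in> ball 0 1 - {0}" and zw: "1 / z + p z = 1 / w + p w"
      have e1: "\<psi> (z ^ 2) / z = \<psi> (w ^ 2) / w" using zw z w eq by simp
      hence "(\<psi> (z ^ 2) / z)\<^sup>2 = (\<psi> (w ^ 2) / w)\<^sup>2" by simp
      hence "1 / f (z ^ 2) = 1 / f (w ^ 2)"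
        using recip[of "z ^ 2"] recip[of "w ^ 2"] sq z w by (simp add: power_divide)
      hence "z ^ 2 = w ^ 2" using inj_onD[OF inj] sq z w by simp
      \<comment> \<open>The function \<open>\<psi> (z ^ 2) / z\<close> is odd without zeros, so it
        separates \<open>w\<close> from \<open>- w\<close>.\<close>
      moreover have "z \<noteq> - w"
      proof
        assume "z = - w"
        with e1 w have "\<psi> (w ^ 2) = 0" by (simp add: field_simps)
        thus False using \<psi>sq[of "w ^ 2"] sq[of w] w by simp
      qed
      ultimately show "z = w" by (simp add: power2_eq_iff)
    qed
    have nth: "fps_nth (fps_X * (fps_shift 1 \<Psi> oo fps_X ^ 2)) n = (if odd n then c (n div 2 + 1) else 0)" for n
      by (cases n) (auto simp: fps_nth_compose_X_power c_def)
    \<comment> \<open>The odd indices 1, 3, 5 carry \<open>c 1\<close>, \<open>c 2\<close>,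
      \<open>c 3\<close>, so 6 is the least cutoff that reaches \<open>c 3\<close>.\<close>
    have "{..<6::nat} = {0, 1, 2, 3, 4, 5}" by auto
    with area_theorem[OF hp P injp, of 6, unfolded nth]
    have "(norm (c 1))\<^sup>2 + 3 * (norm (c 2))\<^sup>2 + 5 * (norm (c 3))\<^sup>2 \<le> 1"
      by (simp flip: numeral_2_eq_2)
    moreover have "0 \<le> 3 * (norm (c 2))\<^sup>2" by simp
    ultimately show ?thesis by linarith
  qed

  have Dn: "fps_nth D 0 = 1" "fps_nth D 1 = 2 * c 1" "fps_nth D 2 = 2 * c 2 + (c 1)\<^sup>2"
     "fps_nth D 3 = 2 * c 3 + 2 * c 1 * c 2"
    unfolding D_def fps_mult_nth_upto_3 c_def[symmetric] c0 by (simp_all add: power2_eq_square)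
  have shift: "fps_nth (fps_shift 1 F) 0 = 1" "fps_nth (fps_shift 1 F) 1 = fps_nth F 2"
    "fps_nth (fps_shift 1 F) 2 = fps_nth F 3" "fps_nth (fps_shift 1 F) 3 = fps_nth F 4"
    using F01(2) by (simp_all add: eval_nat_numeral)
  have "fps_nth (fps_shift 1 F * D) n = 0" if "n \<noteq> 0" for n using that by (simp only: D1 fps_one_nth if_False)
  from this[of 1] this[of 2] this[of 3]
  have FD: "fps_nth D 1 + fps_nth F 2 = 0" "fps_nth D 2 + fps_nth F 2 * fps_nth D 1 + fps_nth F 3 = 0"
    "fps_nth D 3 + fps_nth F 2 * fps_nth D 2 + fps_nth F 3 * fps_nth D 1 + fps_nth F 4 = 0"
    unfolding fps_mult_nth_upto_3 shift Dn(1) by simp_all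
  \<comment> \<open>Eliminating \<open>c 2\<close> in favour of \<open>fps_nth D 2\<close> leaves
    only quantities controlled by the two area estimates.\<close>
  have "fps_nth F 2 * fps_nth F 3 - fps_nth F 4 = 2 * c 3 - c 1 * fps_nth D 2 - (c 1) ^ 3"
    using FD Dn(2-4) by algebra
  also have "norm \<dots> \<le> 2 * norm (c 3) + norm (c 1) * 1 + norm (c 1) ^ 3"
    using mult_left_mono[OF D2, of "norm (c 1)"]
    by (intro norm_triangle_le_diff add_mono) (auto simp: norm_mult norm_power)
  also have "\<dots> \<le> bound_fun (norm (c 1))"
  proof -
    have "norm (c 3) \<le> sqrt ((1 - (norm (c 1))\<^sup>2) / 5)"
      using c13 by (intro real_le_rsqrt) simp
    thus ?thesis by (simp add: bound_fun_def real_sqrt_divide)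
  qed
  finally show ?thesis
  proof (rule bexI)
    have "(norm (c 1))\<^sup>2 \<le> 1" using c13 by (smt (verit) zero_le_power2)
    thus "norm (c 1) \<in> {0..1}" by (simp add: abs_square_le_1)
  qed
qed

section \<open>From the given power series to the final estimate\<close>

text \<open>The hypothesis fixes \<open>a\<close> only from index 2 on, so the normalized
  coefficients 0 and 1 are inserted by hand.\<close>

lemma normalized_series_has_fps_expansion:
  fixes f :: "complex \<Rightarrow> complex" and a :: "nat \<Rightarrow> complex"
  assumes "\<And>z. z \<in> unit_disk \<Longrightarrow> (\<lambda>n. a (n + 2) * z ^ (n + 2)) sums (f z - z)"
  shows "f has_fps_expansion Abs_fps (\<lambda>n. if n = 0 then 0 else if n = 1 then 1 else a n)" (is "_ has_fps_expansion ?F")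
proof (rule has_fps_expansionI)
  have "eventually (\<lambda>z. z \<in> ball 0 1) (nhds (0::complex))"
    by (intro eventually_nhds_in_open) auto
  thus "\<forall>\<^sub>F z in nhds 0. (\<lambda>n. fps_nth ?F n * z ^ n) sums f z"
  proof eventually_elim
    case (elim z)
    have "(\<lambda>n. fps_nth ?F (n + 2) * z ^ (n + 2)) sums (f z - z)"
      using assms[OF elim] by simp
    thus ?case
      by (subst (asm) sums_iff_shift) (simp add: numeral_2_eq_2)
  qed
qed

text \<open>The maximum is expressed through a maximizer, and the decimals are read as truncations,
  hence half-open ranges one last digit wide.\<close>

theorem theorem1:
  fixes f :: "complex \<Rightarrow> complex" and a :: "nat \<Rightarrow> complex"
  assumes "f \<in> class_S"
    and "\<And>z. z \<in> unit_disk \<Longrightarrow> (\<lambda>n. a (n + 2) * z ^ (n + 2)) sums (f z - z)"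
  shows "\<exists>x\<^sub>0\<in>{0..1}.
           (\<forall>x\<in>{0..1}. bound_fun x \<le> bound_fun x\<^sub>0) \<and>
           0.9740 \<le> x\<^sub>0 \<and> x\<^sub>0 < 0.9741 \<and>
           2.10064 \<le> bound_fun x\<^sub>0 \<and> bound_fun x\<^sub>0 < 2.10065 \<and>
           norm (a 2 * a 3 - a 4) \<le> bound_fun x\<^sub>0"
proof -
  obtain x\<^sub>0 where x0: "x\<^sub>0 \<in> {0.974..<0.9741}" "\<forall>x\<in>{0..1}. bound_fun x \<le> bound_fun x\<^sub>0"
    "2.10064 \<le> bound_fun x\<^sub>0" "bound_fun x\<^sub>0 < 2.10065"
    using bound_fun_maximizer by blast
  have "f holomorphic_on unit_disk" "inj_on f unit_disk"
    using assms(1) by (auto simp: class_S_def class_A_def analytic_imp_holomorphic)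
  with univalent_coefficient_bound[OF _ normalized_series_has_fps_expansion[OF assms(2)]]
  obtain x where "x \<in> {0..1}" "norm (a 2 * a 3 - a 4) \<le> bound_fun x"
    by auto
  hence "norm (a 2 * a 3 - a 4) \<le> bound_fun x\<^sub>0"
    using x0(2) order_trans by blast
  with x0 show ?thesis
    by (intro bexI[of _ x\<^sub>0]) auto
qed

end
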